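(* Let $(\mathcal W,S)$ be an irreducible Coxeter system with $S$ finite and let $c\in\mathcal W$ be a Coxeter element. The following are equivalent. (a) $|\mathcal W|=2$. (b) All positive roots are $c$-projective. (c) All simple roots are $c$-projective.
   Context: Coxeter setting. $(\mathcal W,S)$ has Coxeter matrix $(m(s,s'))_{s,s'\in S}$. Its Coxeter graph $\Gamma$ has vertex set $\Gamma_0$ with a fixed bijection $\rho:\Gamma_0\to S$; distinct vertices $x,y$ are joined by an edge (exactly one) iff $2<m(\rho(x),\rho(y))\le\infty$; irreducible means that $\Gamma$ is (nonempty and) connected. Graph monoid. $\mathfrak M$ is the quotient of the free monoid on $\Gamma_0$ by the congruence generated by $vw\sim wv$ for all distinct $v,w\in\Gamma_0$ not joined by an edge. Its elements are written as words $X=x_l\cdots x_1$ ($x_j\in\Gamma_0$, $l\ge 0$); $X$ is multiplicity-free if the $x_j$ are pairwise distinct. The letter $\rho$ also denotes the induced monoid homomorphism $\mathfrak M\to\mathcal W$. Roots. $\mathbb V$ is the real vector space with basis $\{\alpha_s\mid s\in S\}$ and symmetric bilinear form $B(\alpha_s,\alpha_{s'})=-2\cos\frac{\pi}{m(s,s')}$ (with $\frac{\pi}{\infty}=0$). $\mathcal W$ acts on $\mathbb V$ by $s\lambda=\lambda-B(\alpha_s,\lambda)\alpha_s$. The roots are the vectors $w(\alpha_s)$, $w\in\mathcal W$, $s\in S$; the $\alpha_s$ are the simple roots. A root is positive ($>0$), resp. negative ($<0$), if all its coordinates in the basis $\{\alpha_s\}$ are $\ge 0$, resp. $\le 0$.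 Coxeter element and admissible words. $c=s_n\cdots s_1$, where $s_1,\dots,s_n$ are all the elements of $S$ in some order, and $v_j=\rho^{-1}(s_j)$. The $c$-orientation of $\Gamma$ directs each edge between $v_i$ and $v_j$ with $j>i$ as $v_j\to v_i$ (it depends only on the element $c$). A sink is a vertex at which no arrow starts. A word $X=x_l\cdots x_1$ is $c$-admissible if $x_1$ is a sink for the $c$-orientation and, for $1<j\le l$, $x_j$ is a sink for the orientation obtained from the $c$-orientation by reversing all arrows incident to $x_1$, then all arrows incident to $x_2$, and so on up to $x_{j-1}$. This is well defined on elements of $\mathfrak M$; $\mathfrak M(c)\subset\mathfrak M$ is the set of $c$-admissible elements. A root $\alpha>0$ is $c$-projective if $\rho(X)\alpha<0$ for some multiplicity-free $X\in\mathfrak M(c)$. *)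

theory Defs
  imports
    "HOL-Algebra.Generated_Groups"
    "HOL-Library.Extended_Nat"
    Complex_Main
begin

section \<open>Presentations\<close>

text \<open>The congruence on the free monoid \<open>lists A\<close> generated by a set of pairs of words.\<close>

inductive monoid_cong :: "'a set \<Rightarrow> ('a list \<times> 'a list) set \<Rightarrow> 'a list \<Rightarrow> 'a list \<Rightarrow> bool"
  for A R where
  gen: "(u, v) \<in> R \<Longrightarrow> u \<in> lists A \<Longrightarrow> v \<in> lists A \<Longrightarrow> monoid_cong A R u v"
| refl: "u \<in> lists A \<Longrightarrow> monoid_cong A R u u"
| sym: "monoid_cong A R u v \<Longrightarrow> monoid_cong A R v u"
| trans: "monoid_cong A R u v \<Longrightarrow> monoid_cong A R v w \<Longrightarrow> monoid_cong A R u w"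
| mult: "monoid_cong A R u u' \<Longrightarrow> monoid_cong A R v v' \<Longrightarrow> monoid_cong A R (u @ v) (u' @ v')"

definition word_prod :: "('a, 'b) monoid_scheme \<Rightarrow> 'a list \<Rightarrow> 'a" where
  "word_prod G ws = foldr (\<lambda>x y. x \<otimes>\<^bsub>G\<^esub> y) ws \<one>\<^bsub>G\<^esub>"


section \<open>Coxeter systems\<close>

definition coxeter_matrix :: "'a set \<Rightarrow> ('a \<Rightarrow> 'a \<Rightarrow> enat) \<Rightarrow> bool" where
  "coxeter_matrix S m \<longleftrightarrow>
     (\<forall>s\<in>S. m s s = 1) \<and> (\<forall>s\<in>S. \<forall>t\<in>S. s \<noteq> t \<longrightarrow> m s t = m t s \<and> 2 \<le> m s t)"

text \<open>The relations \<open>(s t)^m(s,t) = 1\<close> for finite \<open>m(s,t)\<close>. Since \<open>m(s,s) = 1\<close>, they contain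
  \<open>s s = 1\<close>; hence presenting by them as a monoid or as a group gives the same result.\<close>

definition coxeter_relations :: "'a set \<Rightarrow> ('a \<Rightarrow> 'a \<Rightarrow> enat) \<Rightarrow> ('a list \<times> 'a list) set" where
  "coxeter_relations S m =
     {(concat (replicate k [s, t]), []) | s t k. s \<in> S \<and> t \<in> S \<and> m s t = enat k}"

locale coxeter_system = group W for W (structure) +
  fixes S :: "'a set" and m :: "'a \<Rightarrow> 'a \<Rightarrow> enat"
  assumes S_subset: "S \<subseteq> carrier W"
    and matrix: "coxeter_matrix S m"
    and generated: "generate W S = carrier W"
    and presented: "u \<in> lists S \<Longrightarrow> v \<in> lists S \<Longrightarrow>
      word_prod W u = word_prod W v \<longleftrightarrow> monoid_cong S (coxeter_relations S m) u v"
begin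

text \<open>\<open>ss = [s\<^sub>n, \<dots>, s\<^sub>1]\<close> lists the elements of \<open>S\<close>, and \<open>c = s\<^sub>n \<cdots> s\<^sub>1\<close>.\<close>

definition coxeter_word :: "'a \<Rightarrow> 'a list \<Rightarrow> bool" where
  "coxeter_word c ss \<longleftrightarrow> distinct ss \<and> set ss = S \<and> word_prod W ss = c"

definition coxeter_element :: "'a \<Rightarrow> bool" where
  "coxeter_element c \<longleftrightarrow> (\<exists>ss. coxeter_word c ss)"


subsection \<open>Roots\<close>

text \<open>For finite \<open>S\<close>, a vector is given by its coordinates, a function supported on \<open>S\<close>.\<close>

definition simple_root :: "'a \<Rightarrow> 'a \<Rightarrow> real" where
  "simple_root s = (\<lambda>t. if t = s then 1 else 0)"

definition bil_coeff :: "'a \<Rightarrow> 'a \<Rightarrow> real" where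
  "bil_coeff s t = - 2 * cos (case m s t of enat k \<Rightarrow> pi / real k | \<infinity> \<Rightarrow> 0)"

definition bil :: "('a \<Rightarrow> real) \<Rightarrow> ('a \<Rightarrow> real) \<Rightarrow> real" where
  "bil f g = (\<Sum>s\<in>S. \<Sum>t\<in>S. f s * g t * bil_coeff s t)"

definition reflect :: "'a \<Rightarrow> ('a \<Rightarrow> real) \<Rightarrow> 'a \<Rightarrow> real" where
  "reflect s f = (\<lambda>t. f t - bil (simple_root s) f * simple_root s t)"

text \<open>The action of \<open>W\<close> extending \<open>reflect\<close>. It does not depend on the chosen word; see
  \<open>act_word_prod\<close>, \<open>act_one\<close>, \<open>act_mult\<close> and \<open>act_generator\<close> below.\<close>

definition act :: "'a \<Rightarrow> ('a \<Rightarrow> real) \<Rightarrow> 'a \<Rightarrow> real" where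
  "act w = (THE F. \<exists>ws\<in>lists S. word_prod W ws = w \<and> F = foldr reflect ws)"

definition roots :: "('a \<Rightarrow> real) set" where
  "roots = {act w (simple_root s) | w s. w \<in> carrier W \<and> s \<in> S}"

definition pos :: "('a \<Rightarrow> real) \<Rightarrow> bool" where
  "pos f \<longleftrightarrow> (\<forall>s\<in>S. 0 \<le> f s)"

definition neg :: "('a \<Rightarrow> real) \<Rightarrow> bool" where
  "neg f \<longleftrightarrow> (\<forall>s\<in>S. f s \<le> 0)"

lemma word_prod_Nil [simp]: "word_prod W [] = \<one>"
  by (simp add: word_prod_def)

lemma word_prod_Cons [simp]: "word_prod W (x # xs) = x \<otimes> word_prod W xs"
  by (simp add: word_prod_def)

lemma word_prod_closed: "ws \<in> lists S \<Longrightarrow> word_prod W ws \<in> carrier W"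
  using S_subset by (induction ws) auto

lemma word_prod_append:
  "u \<in> lists S \<Longrightarrow> v \<in> lists S \<Longrightarrow> word_prod W (u @ v) = word_prod W u \<otimes> word_prod W v"
proof (induction u)
  case (Cons a u)
  have "a \<in> carrier W" "word_prod W u \<in> carrier W" "word_prod W v \<in> carrier W"
    using Cons S_subset by (auto intro!: word_prod_closed)
  thus ?case using Cons by (simp add: m_assoc)
qed (simp add: word_prod_closed)

lemma inv_generator: assumes "s \<in> S" shows "inv s = s"
proof -
  have "(concat (replicate 1 [s, s]), []) \<in> coxeter_relations S m"
    using assms matrix unfolding coxeter_relations_def coxeter_matrix_def
    by (force simp: one_enat_def)
  hence "monoid_cong S (coxeter_relations S m) [s, s] []"
    using assms by (intro monoid_cong.gen) auto
  hence "word_prod W [s, s] = word_prod W []"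
    using presented[of "[s, s]" "[]"] assms by auto
  thus ?thesis using assms S_subset by (auto intro!: inv_equality)
qed

lemma word_exists: assumes "w \<in> carrier W" shows "\<exists>ws\<in>lists S. word_prod W ws = w"
proof -
  have "w \<in> generate W S" using assms generated by simp
  thus ?thesis
  proof induction
    case one
    show ?case by (intro bexI[of _ "[]"]) auto
  next
    case (incl h)
    thus ?case using S_subset by (intro bexI[of _ "[h]"]) auto
  next
    case (inv h)
    thus ?case using S_subset by (intro bexI[of _ "[h]"]) (auto simp: inv_generator)
  next
    case (eng h1 h2)
    then obtain u v where "u \<in> lists S" "v \<in> lists S" "word_prod W u = h1" "word_prod W v = h2"
      by blast
    thus ?case by (intro bexI[of _ "u @ v"]) (auto simp: word_prod_append)
  qed
qed

context
  assumes fin: "finite S"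
begin

lemma bil_simple: assumes "s \<in> S" shows "bil (simple_root s) f = (\<Sum>t\<in>S. f t * bil_coeff s t)"
proof -
  have "bil (simple_root s) f = (\<Sum>u\<in>S. if u = s then (\<Sum>t\<in>S. f t * bil_coeff s t) else 0)"
    unfolding bil_def simple_root_def by (intro sum.cong) auto
  thus ?thesis using fin assms by simp
qed

lemma bil_comb:
  assumes "s \<in> S" "t \<in> S" "r \<in> S"
  shows "bil (simple_root r) (\<lambda>x. g x + a * simple_root s x + b * simple_root t x) =
    bil (simple_root r) g + a * bil_coeff r s + b * bil_coeff r t"
proof -
  have "(\<Sum>x\<in>S. simple_root u x * bil_coeff r x) = bil_coeff r u" if "u \<in> S" for u
    using fin that by (simp add: simple_root_def if_distrib[of "\<lambda>x. x * _"] cong: if_cong)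
  thus ?thesis using assms
    by (simp add: bil_simple distrib_right sum.distrib mult.assoc flip: sum_distrib_left)
qed

lemma reflect_involution: assumes "s \<in> S" shows "reflect s (reflect s f) = f"
proof -
  have "bil_coeff s s = 2"
    using assms matrix by (simp add: bil_coeff_def coxeter_matrix_def one_enat_def)
  hence "bil (simple_root s) (reflect s f) = - bil (simple_root s) f"
    using bil_comb[of s s s f "- bil (simple_root s) f" 0] assms by (simp add: reflect_def)
  thus ?thesis unfolding reflect_def[of s "reflect s f"] by (auto simp: reflect_def)
qed

lemma reflect_relation:
  assumes "s \<in> S" "t \<in> S" "m s t = enat k"
  shows "foldr reflect (concat (replicate k [s, t])) = id"
proof (cases "s = t")
  case True
  hence "k = 1" using assms matrix by (auto simp: coxeter_matrix_def one_enat_def)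
  thus ?thesis using True assms by (auto simp: reflect_involution)
next
  case False
  have "2 \<le> m s t" and sym: "m t s = enat k"
    using assms False matrix by (metis coxeter_matrix_def)+
  hence k: "k \<ge> 2" using assms by (simp add: numeral_eq_enat)
  define th where "th = pi / real k"
  have "sin th > 0" using k by (intro sin_gt_zero) (auto simp: th_def field_simps)
  hence sin: "sin th \<noteq> 0" by simp
  have st: "bil_coeff s t = -2 * cos th" "bil_coeff t s = -2 * cos th"
    using assms sym by (auto simp: bil_coeff_def th_def)
  have ss: "bil_coeff s s = 2" "bil_coeff t t = 2"
    using assms matrix by (auto simp: bil_coeff_def coxeter_matrix_def one_enat_def)
  show ?thesis
  proof
    fix f
    define P Q where "P = bil (simple_root s) f" and "Q = bil (simple_root t) f"
    define a b where "a = (P + cos th * Q) / (2 * (sin th)\<^sup>2)"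
      and "b = (Q + cos th * P) / (2 * (sin th)\<^sup>2)"
    define g where "g = (\<lambda>x. f x + (-a) * simple_root s x + (-b) * simple_root t x)"
    have g0: "bil (simple_root s) g = 0" "bil (simple_root t) g = 0"
    proof -
      have *: "(x + cos th * y) / (2 * (sin th)\<^sup>2) * 2
          - 2 * cos th * ((y + cos th * x) / (2 * (sin th)\<^sup>2)) = x" for x y
      proof -
        have "(x + cos th * y) / (2 * (sin th)\<^sup>2) * 2
            - 2 * cos th * ((y + cos th * x) / (2 * (sin th)\<^sup>2))
            = ((1 - (cos th)\<^sup>2) * x) / (sin th)\<^sup>2"
          using sin by (simp add: field_simps power2_eq_square)
        thus ?thesis using sin by (simp add: sin_squared_eq[symmetric])
      qed
      have "bil (simple_root s) g = P - (a * 2 - 2 * cos th * b)"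
        unfolding g_def P_def by (subst bil_comb) (use assms in \<open>simp_all add: ss st\<close>)
      thus "bil (simple_root s) g = 0" using *[of P Q] by (simp add: a_def b_def)
      have "bil (simple_root t) g = Q - (b * 2 - 2 * cos th * a)"
        unfolding g_def Q_def by (subst bil_comb) (use assms in \<open>simp_all add: ss st\<close>)
      thus "bil (simple_root t) g = 0" using *[of Q P] by (simp add: a_def b_def)
    qed
    define q p where "q = b" and "p = (a - b * cos th) / sin th"
    define h where "h = (\<lambda>\<phi>. p * sin \<phi> + q * cos \<phi>)"
    define vec where
      "vec = (\<lambda>\<phi> \<psi> x. g x + h \<phi> * simple_root s x + h \<psi> * simple_root t x)"
    have h: "2 * cos th * h \<phi> - h (\<phi> - th) = h (\<phi> + th)" for \<phi>
      by (simp add: h_def sin_add cos_add sin_diff cos_diff algebra_simps)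
    have rt: "reflect t (vec (\<phi> + th) \<phi>) = vec (\<phi> + th) (\<phi> + 2 * th)" for \<phi>
    proof -
      have B: "bil (simple_root t) (vec (\<phi> + th) \<phi>) = 2 * h \<phi> - 2 * cos th * h (\<phi> + th)"
        unfolding vec_def using assms by (simp add: bil_comb g0 ss st)
      have "h (\<phi> + 2 * th) = 2 * cos th * h (\<phi> + th) - h \<phi>"
        using h[of "\<phi> + th"] by (simp add: add.assoc)
      thus ?thesis unfolding reflect_def B by (simp add: vec_def fun_eq_iff left_diff_distrib)
    qed
    have rs: "reflect s (vec (\<phi> - th) \<phi>) = vec (\<phi> + th) \<phi>" for \<phi>
    proof -
      have B: "bil (simple_root s) (vec (\<phi> - th) \<phi>) = 2 * h (\<phi> - th) - 2 * cos th * h \<phi>"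
        unfolding vec_def using assms by (simp add: bil_comb g0 ss st)
      have "h (\<phi> + th) = 2 * cos th * h \<phi> - h (\<phi> - th)"
        using h[of \<phi>] by simp
      thus ?thesis unfolding reflect_def B by (simp add: vec_def fun_eq_iff left_diff_distrib)
    qed
    have step: "reflect s (reflect t (vec (\<phi> + th) \<phi>)) = vec (\<phi> + 2 * th + th) (\<phi> + 2 * th)" for \<phi>
      using rs[of "\<phi> + 2 * th"] by (simp add: rt algebra_simps)
    have it: "foldr reflect (concat (replicate n [s, t])) (vec th 0)
        = vec (2 * real n * th + th) (2 * real n * th)" for n
    proof (induction n)
      case (Suc n)
      thus ?case using step[of "2 * real n * th"] by (simp add: algebra_simps)
    qed simp
    have "2 * real k * th = 2 * pi" using k by (simp add: th_def)
    hence "vec (2 * real k * th + th) (2 * real k * th) = vec (2 * pi + th) (2 * pi)"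
      by (simp only:)
    also have "\<dots> = vec th 0"
      by (simp add: vec_def h_def sin_add cos_add)
    finally have "vec (2 * real k * th + th) (2 * real k * th) = vec th 0" .
    moreover have "vec th 0 = f"
      using sin by (auto simp: vec_def h_def p_def q_def g_def field_simps)
    ultimately show "foldr reflect (concat (replicate k [s, t])) f = id f"
      using it[of k] by simp
  qed
qed

lemma reflect_cong:
  "monoid_cong S (coxeter_relations S m) u v \<Longrightarrow> foldr reflect u = foldr reflect v"
proof (induction rule: monoid_cong.induct)
  case (gen u v)
  thus ?case by (auto simp: coxeter_relations_def reflect_relation)
next
  case (mult u u' v v')
  thus ?case by (metis foldr_append)
qed auto

lemma act_word_prod: assumes "ws \<in> lists S" shows "act (word_prod W ws) = foldr reflect ws"
  unfolding act_def
proof (rule the_equality)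
  show "\<exists>ws'\<in>lists S. word_prod W ws' = word_prod W ws \<and> foldr reflect ws = foldr reflect ws'"
    using assms by blast
qed (use assms presented reflect_cong in blast)

lemma act_one: "act \<one> = id"
  using act_word_prod[of "[]"] by (simp add: fun_eq_iff)

lemma act_mult:
  assumes "v \<in> carrier W" "w \<in> carrier W" shows "act (v \<otimes> w) = act v \<circ> act w"
proof -
  obtain x y where xy: "x \<in> lists S" "y \<in> lists S" "word_prod W x = v" "word_prod W y = w"
    using word_exists assms by metis
  have "act (v \<otimes> w) = foldr reflect (x @ y)"
    using act_word_prod[of "x @ y"] xy by (simp add: word_prod_append)
  also have "\<dots> = foldr reflect x \<circ> foldr reflect y" by (simp add: fun_eq_iff)
  finally show ?thesis using xy act_word_prod by metis
qed

lemma act_generator: "s \<in> S \<Longrightarrow> act s = reflect s"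
  using act_word_prod[of "[s]"] S_subset by (auto simp: fun_eq_iff)

end

end


section \<open>Coxeter graph and graph monoid\<close>

text \<open>Orientations are sets of arrows \<open>(x, y)\<close>, read \<open>x \<rightarrow> y\<close>.\<close>

definition reverse_at :: "'v \<Rightarrow> 'v rel \<Rightarrow> 'v rel" where
  "reverse_at x Q = {(a, b) \<in> Q. a \<noteq> x \<and> b \<noteq> x} \<union> {(b, a) | a b. (a, b) \<in> Q \<and> (a = x \<or> b = x)}"

definition sink :: "'v \<Rightarrow> 'v rel \<Rightarrow> bool" where
  "sink x Q \<longleftrightarrow> (\<forall>y. (x, y) \<notin> Q)"

text \<open>Here letters are listed in the order of the successive reversals.\<close>

primrec sink_sequence :: "'v rel \<Rightarrow> 'v list \<Rightarrow> bool" where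
  "sink_sequence Q [] \<longleftrightarrow> True"
| "sink_sequence Q (x # xs) \<longleftrightarrow> sink x Q \<and> sink_sequence (reverse_at x Q) xs"

locale coxeter_graph = coxeter_system W S m
  for W :: "('a, 'b) monoid_scheme" (structure) and S and m +
  fixes \<Gamma>\<^sub>0 :: "'v set" and \<rho> :: "'v \<Rightarrow> 'a"
  assumes rho_bij: "bij_betw \<rho> \<Gamma>\<^sub>0 S"
begin

definition edge :: "'v \<Rightarrow> 'v \<Rightarrow> bool" where
  "edge x y \<longleftrightarrow> x \<in> \<Gamma>\<^sub>0 \<and> y \<in> \<Gamma>\<^sub>0 \<and> x \<noteq> y \<and> 2 < m (\<rho> x) (\<rho> y)"

definition irreducible_system :: bool where
  "irreducible_system \<longleftrightarrow> \<Gamma>\<^sub>0 \<noteq> {} \<and> (\<forall>x\<in>\<Gamma>\<^sub>0. \<forall>y\<in>\<Gamma>\<^sub>0. edge\<^sup>*\<^sup>* x y)"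

definition commutations :: "('v list \<times> 'v list) set" where
  "commutations = {([v, w], [w, v]) | v w. v \<in> \<Gamma>\<^sub>0 \<and> w \<in> \<Gamma>\<^sub>0 \<and> v \<noteq> w \<and> \<not> edge v w}"

definition word_equiv :: "('v list \<times> 'v list) set" where
  "word_equiv = {(u, v). monoid_cong \<Gamma>\<^sub>0 commutations u v}"

text \<open>A word \<open>x\<^sub>l \<cdots> x\<^sub>1\<close> is the list \<open>[x\<^sub>l, \<dots>, x\<^sub>1]\<close>.\<close>

definition graph_monoid :: "'v list set monoid" where
  "graph_monoid = \<lparr>carrier = lists \<Gamma>\<^sub>0 // word_equiv,
     mult = (\<lambda>X Y. \<Union>x\<in>X. \<Union>y\<in>Y. word_equiv `` {x @ y}),
     one = word_equiv `` {[]}\<rparr>"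

text \<open>The homomorphism induced by \<open>\<rho>\<close>; all words representing \<open>X\<close> have the same image.\<close>

definition rho_hom :: "'v list set \<Rightarrow> 'a" where
  "rho_hom X = the_elem ((\<lambda>xs. word_prod W (map \<rho> xs)) ` X)"

definition multiplicity_free :: "'v list set \<Rightarrow> bool" where
  "multiplicity_free X \<longleftrightarrow> (\<exists>xs\<in>X. distinct xs)"

text \<open>In \<open>c = s\<^sub>n \<cdots> s\<^sub>1\<close> the factor \<open>s\<^sub>j\<close> stands to the left of \<open>s\<^sub>i\<close> iff \<open>j > i\<close>. All Coxeter
  words for \<open>c\<close> induce the same orientation, so one may quantify existentially over them.\<close>

definition c_orientation :: "'a \<Rightarrow> 'v rel" where
  "c_orientation c = {(x, y). edge x y \<and>
     (\<exists>us vs ws. coxeter_word c (us @ \<rho> x # vs @ \<rho> y # ws))}"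

text \<open>The first reversal takes place at the rightmost letter, hence \<open>rev\<close>.\<close>

definition admissible_word :: "'a \<Rightarrow> 'v list \<Rightarrow> bool" where
  "admissible_word c xs \<longleftrightarrow> sink_sequence (c_orientation c) (rev xs)"

definition admissible :: "'a \<Rightarrow> 'v list set set" where
  "admissible c = {X \<in> carrier graph_monoid. \<exists>xs\<in>X. admissible_word c xs}"

definition c_projective :: "'a \<Rightarrow> ('a \<Rightarrow> real) \<Rightarrow> bool" where
  "c_projective c \<alpha> \<longleftrightarrow> \<alpha> \<in> roots \<and> pos \<alpha> \<and>
     (\<exists>X\<in>admissible c. multiplicity_free X \<and> neg (act (rho_hom X) \<alpha>))"


subsection \<open>Independence of the representing word\<close>

lemma cong_in_lists:
  "monoid_cong \<Gamma>\<^sub>0 commutations u v \<Longrightarrow> u \<in> lists \<Gamma>\<^sub>0 \<and> v \<in> lists \<Gamma>\<^sub>0"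
  by (induction rule: monoid_cong.induct) auto

lemma equiv_word_equiv: "equiv (lists \<Gamma>\<^sub>0) word_equiv"
  by (intro equivI refl_onI symI transI)
    (auto simp: word_equiv_def intro: monoid_cong.refl monoid_cong.sym monoid_cong.trans
      dest: cong_in_lists)

lemma rho_lists: "xs \<in> lists \<Gamma>\<^sub>0 \<Longrightarrow> map \<rho> xs \<in> lists S"
  using rho_bij by (auto simp: bij_betw_def)

lemma cong_rho:
  "monoid_cong \<Gamma>\<^sub>0 commutations u v \<Longrightarrow> word_prod W (map \<rho> u) = word_prod W (map \<rho> v)"
proof (induction rule: monoid_cong.induct)
  case (gen u v)
  then obtain x y where xy: "u = [x, y]" "v = [y, x]" "x \<in> \<Gamma>\<^sub>0" "y \<in> \<Gamma>\<^sub>0" "x \<noteq> y" "\<not> edge x y"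
    by (auto simp: commutations_def)
  let ?s = "\<rho> x" and ?t = "\<rho> y"
  have S: "?s \<in> S" "?t \<in> S" "?s \<noteq> ?t"
    using xy rho_bij by (auto simp: bij_betw_def inj_on_def)
  hence C: "?s \<in> carrier W" "?t \<in> carrier W" using S_subset by auto
  have "m ?s ?t = enat 2"
    using xy S matrix
    by (auto simp: edge_def coxeter_matrix_def not_less numeral_eq_enat intro: antisym)
  hence "(concat (replicate 2 [?s, ?t]), []) \<in> coxeter_relations S m"
    using S unfolding coxeter_relations_def by blast
  hence "monoid_cong S (coxeter_relations S m) [?s, ?t, ?s, ?t] []"
    using S by (intro monoid_cong.gen) (auto simp: numeral_2_eq_2)
  hence "word_prod W [?s, ?t, ?s, ?t] = word_prod W []"
    using presented[of "[?s, ?t, ?s, ?t]" "[]"] S by auto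
  hence "(?s \<otimes> ?t) \<otimes> (?s \<otimes> ?t) = \<one>" using C by (simp add: m_assoc)
  hence "?s \<otimes> ?t = inv (?s \<otimes> ?t)" using C by (metis inv_equality m_closed)
  also have "\<dots> = ?t \<otimes> ?s" using C S by (simp add: inv_mult_group inv_generator)
  finally show ?case using xy C by simp
next
  case (mult u u' v v')
  have "u \<in> lists \<Gamma>\<^sub>0" "u' \<in> lists \<Gamma>\<^sub>0" "v \<in> lists \<Gamma>\<^sub>0" "v' \<in> lists \<Gamma>\<^sub>0"
    using mult.hyps cong_in_lists by blast+
  thus ?case using mult.IH word_prod_append[OF rho_lists rho_lists] by simp
qed auto

lemma rho_hom_eq:
  assumes "X \<in> carrier graph_monoid" "xs \<in> X"
  shows "rho_hom X = word_prod W (map \<rho> xs)"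
proof -
  have "word_prod W (map \<rho> ys) = word_prod W (map \<rho> xs)" if "ys \<in> X" for ys
  proof -
    have "X \<in> lists \<Gamma>\<^sub>0 // word_equiv" using assms(1) by (simp add: graph_monoid_def)
    hence "(ys, xs) \<in> word_equiv"
      using quotient_eq_iff[OF equiv_word_equiv] assms(2) that by blast
    thus ?thesis using cong_rho by (simp add: word_equiv_def)
  qed
  hence "(\<lambda>xs. word_prod W (map \<rho> xs)) ` X = {word_prod W (map \<rho> xs)}"
    using assms(2) by blast
  thus ?thesis by (simp add: rho_hom_def)
qed

lemma cong_distinct:
  "monoid_cong \<Gamma>\<^sub>0 commutations u v \<Longrightarrow> set u = set v \<and> distinct u = distinct v"
  by (induction rule: monoid_cong.induct) (auto simp: commutations_def)

lemma c_orientation_edge: "c_orientation c \<subseteq> {(x, y). edge x y}"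
  by (auto simp: c_orientation_def)

lemma edge_sym: "edge x y \<Longrightarrow> edge y x"
  using rho_bij matrix unfolding edge_def bij_betw_def coxeter_matrix_def inj_on_def
  by (metis imageI)

lemma reverse_at_edge: "Q \<subseteq> {(x, y). edge x y} \<Longrightarrow> reverse_at z Q \<subseteq> {(x, y). edge x y}"
  by (auto simp: reverse_at_def intro: edge_sym)

lemma sink_sequence_append:
  "sink_sequence Q (xs @ ys) \<longleftrightarrow> sink_sequence Q xs \<and> sink_sequence (fold reverse_at xs Q) ys"
  by (induction xs arbitrary: Q) auto

lemma cong_sink_sequence:
  "monoid_cong \<Gamma>\<^sub>0 commutations u v \<Longrightarrow> Q \<subseteq> {(x, y). edge x y} \<Longrightarrow>
     sink_sequence Q (rev u) = sink_sequence Q (rev v) \<and>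
     fold reverse_at (rev u) Q = fold reverse_at (rev v) Q \<and>
     fold reverse_at (rev u) Q \<subseteq> {(x, y). edge x y}"
proof (induction arbitrary: Q rule: monoid_cong.induct)
  case (gen u v)
  then obtain x y where xy: "u = [x, y]" "v = [y, x]" "x \<noteq> y" "\<not> edge x y"
    by (auto simp: commutations_def)
  hence n: "(x, y) \<notin> Q" "(y, x) \<notin> Q" using gen edge_sym by auto
  have "reverse_at x (reverse_at y Q) = reverse_at y (reverse_at x Q)"
    using n xy(3) unfolding reverse_at_def by blast
  moreover have "sink x (reverse_at y Q) \<longleftrightarrow> sink x Q" "sink y (reverse_at x Q) \<longleftrightarrow> sink y Q"
    using n xy(3) unfolding reverse_at_def sink_def by blast+
  ultimately show ?case
    using xy gen(4) reverse_at_edge[OF reverse_at_edge[OF gen(4)]] by auto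
next
  case (refl u)
  have "fold reverse_at ws Q \<subseteq> {(x, y). edge x y}" for ws
    using refl(2) by (induction ws arbitrary: Q) (auto simp: reverse_at_edge)
  thus ?case by simp
next
  case (mult u u' v v')
  show ?case using mult.IH(2)[OF mult.prems] mult.IH(1)[of "fold reverse_at (rev v) Q"]
    by (auto simp: sink_sequence_append)
next
  case (sym u v)
  thus ?case using sym.IH[OF sym.prems] by simp
next
  case (trans u v w)
  thus ?case using trans.IH(1)[OF trans.prems] trans.IH(2)[OF trans.prems] by simp
qed

lemma cong_admissible:
  "monoid_cong \<Gamma>\<^sub>0 commutations u v \<Longrightarrow> admissible_word c u = admissible_word c v"
  unfolding admissible_word_def using cong_sink_sequence[OF _ c_orientation_edge] by simp

end

end

theory Submission
  imports Defs
begin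

text \<open>
  For (c) \<open>\<Longrightarrow>\<close> (a), let \<open>s\<close> be the leftmost letter of a Coxeter word for \<open>c\<close>; its vertex is a source.
  If \<open>s\<close> has a neighbour \<open>t\<close>, then \<open>\<alpha>\<^sub>s\<close> is not \<open>c\<close>-projective: let \<open>X\<close> be multiplicity-free and
  admissible. If \<open>s\<close> does not occur in \<open>X\<close>, the \<open>s\<close>-coordinate of \<open>\<rho>(X)\<alpha>\<^sub>s\<close> is \<open>1\<close>. Otherwise the arrow
  from \<open>s\<close> to \<open>t\<close> must have been reversed at \<open>t\<close> before \<open>s\<close> is used. At that moment all coordinates
  are nonnegative, the \<open>s\<close>-coordinate is \<open>1\<close> and the \<open>t\<close>-coordinate is \<open>0\<close>, so the \<open>t\<close>-coordinate
  becomes positive; since \<open>t\<close> does not occur again, it stays so.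
\<close>

section \<open>Signs of coordinates under successive simple reflections\<close>

context coxeter_system
begin

lemma bil_coeff_diag: "s \<in> S \<Longrightarrow> bil_coeff s s = 2"
  using matrix by (simp add: bil_coeff_def coxeter_matrix_def one_enat_def)

text \<open>A finite label is at least 2, so its angle lies between 0 and \<pi>/2, where cosine is
  nonnegative; an infinite label has angle 0 and coefficient -2.\<close>

lemma bil_coeff_nonpos:
  assumes "s \<in> S" "t \<in> S" "s \<noteq> t"
  shows "bil_coeff s t \<le> 0"
proof (cases "m s t")
  case (enat k)
  have "2 \<le> m s t" using assms matrix by (simp add: coxeter_matrix_def)
  hence "2 \<le> k" using enat by (simp add: numeral_eq_enat)
  hence "0 \<le> pi / real k" "pi / real k \<le> pi / 2"
    by (simp_all add: field_simps)
  hence "0 \<le> cos (pi / real k)" using pi_gt_zero by (intro cos_ge_zero) linarith+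
  thus ?thesis by (simp add: bil_coeff_def enat)
qed (simp add: bil_coeff_def)

lemma bil_coeff_neg:
  assumes "2 < m s t"
  shows "bil_coeff s t < 0"
proof (cases "m s t")
  case (enat k)
  hence "2 < k" using assms by (simp add: numeral_eq_enat)
  hence "0 < pi / real k" "pi / real k < pi / 2"
    by (simp_all add: field_simps)
  hence "0 < cos (pi / real k)" by (intro cos_gt_zero)
  thus ?thesis by (simp add: bil_coeff_def enat)
qed (simp add: bil_coeff_def)

lemma reflect_other: "t \<noteq> s \<Longrightarrow> reflect s f t = f t"
  by (simp add: reflect_def simple_root_def)

lemma fold_reflect_other: "t \<notin> set ws \<Longrightarrow> fold reflect ws f t = f t"
  by (induction ws arbitrary: f) (auto simp: reflect_other)

lemma pos_simple_root: "pos (simple_root s)"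
  by (simp add: pos_def simple_root_def)

context
  assumes fin: "finite S"
begin

lemma reflect_same:
  assumes "s \<in> S"
  shows "reflect s f s = - f s - (\<Sum>t\<in>S - {s}. f t * bil_coeff s t)"
  using assms fin
  by (simp add: reflect_def fun_cong[OF simple_root_def] bil_simple[OF fin] sum.remove[of S s]
      bil_coeff_diag)

text \<open>With \<open>f s = 0\<close>, the new coordinate is minus a sum of products of
  nonnegative coordinates and nonpositive coefficients.\<close>

lemma reflect_same_nonneg:
  assumes "s \<in> S" "f s = 0" "\<And>t. t \<in> S \<Longrightarrow> 0 \<le> f t"
  shows "0 \<le> reflect s f s"
proof -
  have "(\<Sum>t\<in>S - {s}. f t * bil_coeff s t) \<le> 0"
    using assms by (intro sum_nonpos mult_nonneg_nonpos bil_coeff_nonpos) auto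
  thus ?thesis using assms by (simp add: reflect_same)
qed

lemma reflect_same_pos:
  assumes "s \<in> S" "f s = 0" "\<And>t. t \<in> S \<Longrightarrow> 0 \<le> f t"
    and "r \<in> S" "r \<noteq> s" "0 < f r" "2 < m s r"
  shows "0 < reflect s f s"
proof -
  \<comment> \<open>The term of the neighbour \<open>r\<close> is split off: it alone makes the sum
    strictly negative.\<close>
  have "(\<Sum>t\<in>S - {s} - {r}. f t * bil_coeff s t) \<le> 0"
    using assms by (intro sum_nonpos mult_nonneg_nonpos bil_coeff_nonpos) auto
  moreover have "f r * bil_coeff s r < 0"
    using assms by (intro mult_pos_neg bil_coeff_neg)
  ultimately have "(\<Sum>t\<in>S - {s}. f t * bil_coeff s t) < 0"
    using assms fin by (simp add: sum.remove[of "S - {s}" r])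
  thus ?thesis using assms by (simp add: reflect_same)
qed

text \<open>Each reflection changes only its own coordinate. As the letters are distinct, every
  coordinate is still 0 when its turn comes, so \<open>reflect_same_nonneg\<close> applies each
  time.\<close>

lemma fold_reflect_nonneg:
  assumes "distinct ws" "set ws \<subseteq> S" "\<And>t. t \<in> S \<Longrightarrow> 0 \<le> f t"
    and "\<And>t. t \<in> set ws \<Longrightarrow> f t = 0" "u \<in> S"
  shows "0 \<le> fold reflect ws f u"
  using assms
proof (induction ws arbitrary: f)
  case (Cons w ws)
  have "0 \<le> reflect w f t" if "t \<in> S" for t
    using reflect_same_nonneg[of w f] Cons.prems that by (cases "t = w") (auto simp: reflect_other)
  moreover have "reflect w f t = 0" if "t \<in> set ws" for t
    using Cons.prems that by (subst reflect_other) auto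
  ultimately show ?case using Cons by simp
qed simp

text \<open>The letter \<open>s\<close> may occur in \<open>vs\<close>, and coordinates may then
  become negative; the \<open>t\<close>-coordinate is safe because \<open>t\<close> does not occur
  in \<open>vs\<close>.\<close>

lemma fold_reflect_simple_root_pos:
  assumes "distinct (us @ t # vs)" "set (us @ t # vs) \<subseteq> S"
    and "s \<in> S" "s \<notin> set us" "s \<noteq> t" "2 < m t s"
  shows "0 < fold reflect (us @ t # vs) (simple_root s) t"
proof -
  define g where "g = fold reflect us (simple_root s)"
  have "0 \<le> g u" if "u \<in> S" for u
    unfolding g_def using assms that
    by (intro fold_reflect_nonneg) (auto simp: simple_root_def)
  moreover have "g s = 1" "g t = 0"
    using assms by (auto simp: g_def fold_reflect_other simple_root_def)
  ultimately have "0 < reflect t g t"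
    using assms by (intro reflect_same_pos[where r = s]) auto
  thus ?thesis using assms by (simp add: fold_reflect_other flip: g_def)
qed

section \<open>Simple roots and the order of \<open>W\<close>\<close>

lemma simple_root_in_roots: "s \<in> S \<Longrightarrow> simple_root s \<in> roots"
  unfolding roots_def by (force simp: act_one[OF fin] intro: exI[of _ \<one>])

lemma reflect_simple_root: "s \<in> S \<Longrightarrow> reflect s (simple_root s) s = -1"
  by (simp add: reflect_same simple_root_def)

text \<open>The action separates the two elements: \<open>s\<close> turns the coordinate 1 of its
  simple root into -1, whereas \<open>\<one>\<close> fixes it.\<close>

lemma generator_neq_one: "s \<in> S \<Longrightarrow> s \<noteq> \<one>"
  using reflect_simple_root[of s] act_generator[OF fin, of s] act_one[OF fin]
  by (auto simp: simple_root_def)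

lemma carrier_singleton:
  assumes "S = {s}"
  shows "carrier W = {\<one>, s}"
proof -
  have s: "s \<in> carrier W" "inv s = s" using assms S_subset inv_generator by auto
  hence "s \<otimes> s = \<one>" by (metis r_inv)
  hence "word_prod W ws \<in> {\<one>, s}" if "ws \<in> lists S" for ws
    using that s assms by (induction ws) auto
  thus ?thesis using word_exists s by blast
qed

lemma order_eq_2_iff: "S \<noteq> {} \<Longrightarrow> order W = 2 \<longleftrightarrow> (\<exists>s. S = {s})"
proof
  assume ne: "S \<noteq> {}" and ord: "order W = 2"
  have fC: "finite (carrier W)" using ord by (auto simp: order_def intro: card_ge_0_finite)
  \<comment> \<open>A group of order 2 has a single element besides \<open>\<one>\<close>, which
    leaves room for only one generator.\<close>
  have "S \<subseteq> carrier W - {\<one>}" using S_subset generator_neq_one by auto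
  hence "card S \<le> card (carrier W - {\<one>})" using fC by (intro card_mono) auto
  also have "\<dots> = 1" using ord by (simp add: order_def card_Diff_singleton)
  finally have "card S = 1" using ne fin card_gt_0_iff[of S] by linarith
  thus "\<exists>s. S = {s}" by (simp add: card_1_singleton_iff)
next
  assume "\<exists>s. S = {s}"
  then obtain s where "S = {s}" by blast
  thus "order W = 2"
    using carrier_singleton[of s] generator_neq_one[of s] by (auto simp: order_def)
qed

end

end

section \<open>Order of the letters in a sink sequence\<close>

lemma sink_sequence_source_after_target:
  assumes "sink_sequence Q xs" "(x, y) \<in> Q" "x \<in> set xs"
  obtains us vs where "xs = us @ y # vs" "x \<notin> set us"
proof -
  have "\<exists>us vs. xs = us @ y # vs \<and> x \<notin> set us"
    using assms
  proof (induction xs arbitrary: Q)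
    case (Cons z xs)
    \<comment> \<open>While the arrow leaves \<open>x\<close>, \<open>x\<close> is no sink; only a
      reversal at \<open>x\<close> or \<open>y\<close> can turn that arrow. Hence \<open>y\<close>
      must come first.\<close>
    have "z \<noteq> x" using Cons.prems by (auto simp: sink_def)
    show ?case
    proof (cases "z = y")
      case True
      thus ?thesis by (intro exI[of _ "[]"] exI[of _ xs]) auto
    next
      case False
      hence "(x, y) \<in> reverse_at z Q"
        using \<open>z \<noteq> x\<close> Cons.prems by (auto simp: reverse_at_def)
      then obtain us vs where "xs = us @ y # vs" "x \<notin> set us"
        using Cons \<open>z \<noteq> x\<close> by fastforce
      thus ?thesis using \<open>z \<noteq> x\<close> by (intro exI[of _ "z # us"] exI[of _ vs]) auto
    qed
  qed simp
  thus thesis using that by blast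
qed

section \<open>Words of admissible elements and arrows of the orientation\<close>

context coxeter_graph
begin

text \<open>Admissibility and distinctness may be witnessed by different words of the class; the
  congruence transfers distinctness to the admissible one. The resulting \<open>xs\<close> is in the
  order of reversals, hence \<open>rev\<close> in the product.\<close>

lemma multiplicity_free_admissibleE:
  assumes "X \<in> admissible c" "multiplicity_free X"
  obtains xs where "set xs \<subseteq> \<Gamma>\<^sub>0" "distinct xs" "sink_sequence (c_orientation c) xs"
    "rho_hom X = word_prod W (rev (map \<rho> xs))"
proof -
  obtain xs where xs: "xs \<in> X" "admissible_word c xs" and X: "X \<in> carrier graph_monoid"
    using assms(1) by (auto simp: admissible_def)
  obtain ys where ys: "ys \<in> X" "distinct ys" using assms(2) by (auto simp: multiplicity_free_def)
  have "(ys, xs) \<in> word_equiv"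
    using X xs(1) ys(1) quotient_eq_iff[OF equiv_word_equiv] by (auto simp: graph_monoid_def)
  hence *: "monoid_cong \<Gamma>\<^sub>0 commutations ys xs" by (simp add: word_equiv_def)
  show thesis
    using that[of "rev xs"] cong_distinct[OF *] cong_in_lists[OF *] ys xs rho_hom_eq[OF X xs(1)]
    by (auto simp: admissible_word_def rev_map)
qed

lemma c_orientation_source:
  assumes "coxeter_word c (\<rho> x # ss)" "edge x y"
  shows "(x, y) \<in> c_orientation c"
proof -
  have "\<rho> y \<in> S" "\<rho> y \<noteq> \<rho> x"
    using assms(2) rho_bij by (auto simp: edge_def bij_betw_def inj_on_def)
  hence "\<rho> y \<in> set ss" using assms(1) by (auto simp: coxeter_word_def)
  then obtain vs ws where "ss = vs @ \<rho> y # ws" by (auto simp: in_set_conv_decomp)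
  \<comment> \<open>The empty prefix matches the pattern in
    \<open>c_orientation_def\<close>.\<close>
  hence "coxeter_word c ([] @ \<rho> x # vs @ \<rho> y # ws)" using assms(1) by simp
  thus ?thesis using assms(2) unfolding c_orientation_def by blast
qed

section \<open>Outgoing arrows as obstructions to projectivity\<close>

context
  assumes fin: "finite S"
begin

lemma source_not_projective:
  assumes "(x, y) \<in> c_orientation c"
  shows "\<not> c_projective c (simple_root (\<rho> x))"
proof
  assume "c_projective c (simple_root (\<rho> x))"
  then obtain X where "X \<in> admissible c" "multiplicity_free X"
    and neg: "neg (act (rho_hom X) (simple_root (\<rho> x)))"
    by (auto simp: c_projective_def)
  then obtain xs where xs: "set xs \<subseteq> \<Gamma>\<^sub>0" "distinct xs" "sink_sequence (c_orientation c) xs"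
    and X: "rho_hom X = word_prod W (rev (map \<rho> xs))"
    by (elim multiplicity_free_admissibleE)
  have S: "set (map \<rho> xs) \<subseteq> S" using xs(1) rho_bij by (auto simp: bij_betw_def)
  have dist: "distinct (map \<rho> xs)"
    using xs rho_bij by (auto simp: distinct_map bij_betw_def intro: inj_on_subset)
  have edge: "edge x y" using assms by (simp add: c_orientation_def)
  hence G: "x \<in> \<Gamma>\<^sub>0" "y \<in> \<Gamma>\<^sub>0" "x \<noteq> y" by (auto simp: edge_def)
  have inj: "\<rho> u = \<rho> v \<longleftrightarrow> u = v" if "u \<in> \<Gamma>\<^sub>0" "v \<in> \<Gamma>\<^sub>0" for u v
    using that rho_bij by (auto simp: bij_betw_def inj_on_def)
  have rS: "\<rho> x \<in> S" "\<rho> y \<in> S" using G rho_bij by (auto simp: bij_betw_def)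
  have "rev (map \<rho> xs) \<in> lists S" using S by auto
  \<comment> \<open>The rightmost letter of a product acts first, so the reflections are applied in
    the order of the sink reversals.\<close>
  hence "act (rho_hom X) = fold reflect (map \<rho> xs)"
    using X by (simp add: act_word_prod[OF fin] foldr_conv_fold)
  hence nonpos: "fold reflect (map \<rho> xs) (simple_root (\<rho> x)) s \<le> 0" if "s \<in> S" for s
    using neg that by (simp add: neg_def)
  show False
  proof (cases "x \<in> set xs")
    case False
    hence "\<rho> x \<notin> set (map \<rho> xs)" using G xs(1) inj by auto
    thus False using nonpos[OF rS(1)] by (simp add: fold_reflect_other simple_root_def)
  next
    case True
    then obtain us vs where uv: "xs = us @ y # vs" "x \<notin> set us"
      using sink_sequence_source_after_target[OF xs(3) assms] by blast
    have "\<rho> x \<notin> set (map \<rho> us)" using uv G xs(1) inj by auto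
    moreover have "2 < m (\<rho> y) (\<rho> x)" using edge_sym[OF edge] by (simp add: edge_def)
    moreover have "\<rho> x \<noteq> \<rho> y" using G inj by blast
    ultimately have "0 < fold reflect (map \<rho> us @ \<rho> y # map \<rho> vs) (simple_root (\<rho> x)) (\<rho> y)"
      using S dist uv(1) rS by (intro fold_reflect_simple_root_pos[OF fin]) auto
    thus False using nonpos[OF rS(2)] uv(1) by simp
  qed
qed

lemma singleton_if_simple_roots_projective:
  assumes "irreducible_system" "coxeter_element c"
    and "\<And>s. s \<in> S \<Longrightarrow> c_projective c (simple_root s)"
  shows "\<exists>s. S = {s}"
proof -
  obtain ws where ws: "coxeter_word c ws" using assms(2) by (auto simp: coxeter_element_def)
  have "S \<noteq> {}" using assms(1) rho_bij by (auto simp: irreducible_system_def bij_betw_def)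
  then obtain s ss where ss: "ws = s # ss" using ws by (cases ws) (auto simp: coxeter_word_def)
  have s: "s \<in> S" using ws ss by (auto simp: coxeter_word_def)
  then obtain x where x: "x \<in> \<Gamma>\<^sub>0" "s = \<rho> x" using rho_bij by (auto simp: bij_betw_def)
  \<comment> \<open>Since \<open>\<rho> x\<close> is leftmost, any edge at \<open>x\<close> would be
    an arrow leaving it, contradicting projectivity of its simple root.\<close>
  have no_edge: "\<not> edge x y" for y
    using c_orientation_source[of c x ss y] source_not_projective[of x y c] assms(3) ws ss x s
    by auto
  have "y = x" if "y \<in> \<Gamma>\<^sub>0" for y
  proof (rule ccontr)
    assume "y \<noteq> x"
    \<comment> \<open>A path from \<open>x\<close> to another vertex would begin with an edge at
      \<open>x\<close>.\<close>
    have "edge\<^sup>*\<^sup>* x y" using assms(1) x that by (simp add: irreducible_system_def)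
    thus False using no_edge \<open>y \<noteq> x\<close> by (auto elim: converse_rtranclpE)
  qed
  hence "\<Gamma>\<^sub>0 = {x}" using x by blast
  hence "S = {\<rho> x}" using rho_bij by (simp add: bij_betw_def)
  thus ?thesis by blast
qed

section \<open>Rank one\<close>

lemma roots_singleton:
  assumes "S = {s}" "\<alpha> \<in> roots" "pos \<alpha>"
  shows "\<alpha> = simple_root s"
proof -
  obtain w where w: "w \<in> {\<one>, s}" "\<alpha> = act w (simple_root s)"
    using assms(2) unfolding roots_def carrier_singleton[OF fin assms(1)]
    by (auto simp only: assms(1) singleton_iff)
  \<comment> \<open>The group is \<open>{\<one>, s}\<close>, so the only other candidate is the
    image under \<open>s\<close>, which is not positive.\<close>
  have "act s (simple_root s) s = -1"
    using assms(1) reflect_simple_root[OF fin, of s] act_generator[OF fin, of s] by simp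
  moreover have "s \<in> S" using assms(1) by simp
  ultimately have "\<not> pos (act s (simple_root s))" by (force simp only: pos_def)
  hence "w = \<one>" using w assms(3) by blast
  thus ?thesis using w by (simp add: act_one[OF fin])
qed

text \<open>The one-letter word works: a lone vertex has no edges, so it is a sink, and its
  reflection negates the simple root.\<close>

lemma simple_root_projective_singleton:
  assumes "S = {s}"
  shows "c_projective c (simple_root s)"
proof -
  obtain x where x: "\<Gamma>\<^sub>0 = {x}" "\<rho> x = s"
  proof -
    have img: "\<rho> ` \<Gamma>\<^sub>0 = {s}" and inj: "inj_on \<rho> \<Gamma>\<^sub>0"
      using rho_bij assms by (auto simp: bij_betw_def)
    then obtain x where x: "x \<in> \<Gamma>\<^sub>0" "\<rho> x = s" by blast
    have "y = x" if "y \<in> \<Gamma>\<^sub>0" for y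
      using img inj_onD[OF inj, of y x] x that by blast
    thus thesis using that[of x] x by blast
  qed
  define X where "X = word_equiv `` {[x]}"
  have X: "X \<in> carrier graph_monoid"
    unfolding X_def graph_monoid_def by (simp add: x(1) quotientI)
  have mem: "[x] \<in> X"
    using x unfolding X_def by (intro equiv_class_self[OF equiv_word_equiv]) auto
  have "\<not> edge x y" for y using x(1) unfolding edge_def by blast
  hence "sink x (c_orientation c)" using c_orientation_edge[of c] unfolding sink_def by blast
  hence "admissible_word c [x]" by (simp add: admissible_word_def)
  hence "X \<in> admissible c" using X mem by (auto simp: admissible_def)
  moreover have "multiplicity_free X" unfolding multiplicity_free_def by (intro bexI[OF _ mem]) simp
  moreover have "s \<in> S" "s \<in> carrier W" using assms S_subset by auto
  hence "act (rho_hom X) = reflect s"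
    by (simp add: rho_hom_eq[OF X mem] x(2) act_generator[OF fin])
  moreover have "neg (reflect s (simple_root s))"
    unfolding neg_def using \<open>s \<in> S\<close> assms reflect_simple_root[OF fin, of s]
    by (metis neg_le_0_iff_le singletonD zero_le_one)
  ultimately show ?thesis
    using simple_root_in_roots[OF fin \<open>s \<in> S\<close>] pos_simple_root
    unfolding c_projective_def by metis
qed

end

end

theorem proposition3p2:
  fixes W :: "('a, 'b) monoid_scheme" and S :: "'a set" and m :: "'a \<Rightarrow> 'a \<Rightarrow> enat"
    and \<Gamma>\<^sub>0 :: "'v set" and \<rho> :: "'v \<Rightarrow> 'a" and c :: 'a
  assumes "coxeter_graph W S m \<Gamma>\<^sub>0 \<rho>"
    and "finite S"
    and "coxeter_graph.irreducible_system m \<Gamma>\<^sub>0 \<rho>"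
    and "coxeter_system.coxeter_element W S c"
  shows "(order W = 2 \<longleftrightarrow>
           (\<forall>\<alpha>\<in>coxeter_system.roots W S m.
              coxeter_system.pos S \<alpha> \<longrightarrow> coxeter_graph.c_projective W S m \<Gamma>\<^sub>0 \<rho> c \<alpha>)) \<and>
         ((\<forall>\<alpha>\<in>coxeter_system.roots W S m.
              coxeter_system.pos S \<alpha> \<longrightarrow> coxeter_graph.c_projective W S m \<Gamma>\<^sub>0 \<rho> c \<alpha>) \<longleftrightarrow>
           (\<forall>s\<in>S. coxeter_graph.c_projective W S m \<Gamma>\<^sub>0 \<rho> c (coxeter_system.simple_root s)))"
proof -
  interpret coxeter_graph W S m \<Gamma>\<^sub>0 \<rho> by (rule assms(1))
  have "S \<noteq> {}" using assms(3) rho_bij by (auto simp: irreducible_system_def bij_betw_def)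
  \<comment> \<open>Statement (a) is used as "\<open>S\<close> is a singleton" in the cycle (a),
    (b), (c), (a).\<close>
  hence ord: "order W = 2 \<longleftrightarrow> (\<exists>s. S = {s})" by (rule order_eq_2_iff[OF assms(2)])
  have ab: "\<forall>\<alpha>\<in>roots. pos \<alpha> \<longrightarrow> c_projective c \<alpha>" if "order W = 2"
    using that ord roots_singleton[OF assms(2)] simple_root_projective_singleton[OF assms(2)]
    by metis
  have bc: "\<forall>s\<in>S. c_projective c (simple_root s)" if "\<forall>\<alpha>\<in>roots. pos \<alpha> \<longrightarrow> c_projective c \<alpha>"
    using that simple_root_in_roots[OF assms(2)] pos_simple_root by blast
  have ca: "order W = 2" if "\<forall>s\<in>S. c_projective c (simple_root s)"
    using that ord singleton_if_simple_roots_projective[OF assms(2-4)] by blast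
  show ?thesis using ab bc ca by blast
qed

end
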